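(* Fix a client $i\in\{1,\dots,N\}$, a reward sequence $(R_t)_{t=0}^{T}$ and a given mean-field sequence $(\phi(t))_{t=0}^{T}$. Consider the discrete-time optimal control problem of maximizing $$U_i=\sum_{t=0}^{T}\Big(1-\big(1-\tfrac{\rho_i^t}{N\phi(t)}\big)^{K}\Big)\Big(\rho_i^tR_t-\varphi_i(\rho_i^t)^2-(1-\varphi_i)(\alpha_i^t)^2\Big)$$ over the correction factors $(\alpha_i^t)_{t}$, subject to $\rho_i^{t+1}=(1-\alpha_i^t)\phi(t)+\alpha_i^t\rho_i^t$, $\alpha_i^t\in(0,1)$. Then the optimal correction factor of client $i$ at iteration $t$ is $$\alpha_i^{t*}=\frac{(\rho_i^t-\phi(t))\Big\{\sum_{j=t+2}^{T}\big[S(j)\prod_{r=t+1}^{j-1}\alpha_i^r\big]+S(t+1)\Big\}}{2(1-\varphi_i)\Big(1-\big(1-\tfrac{\rho_i^t}{N\phi(t)}\big)^{K}\Big)},$$ with $\alpha_i^T=0$ at the final iteration, where $S(t)=Q_i^tR_t+M_i^t$, $$Q_i^t=1-\Big(1-\tfrac{\rho_i^t}{N\phi(t)}\Big)^{K}+\Big(1-\tfrac{\rho_i^t}{N\phi(t)}\Big)^{K-1}\frac{K\rho_i^t}{N\phi(t)},$$ $$M_i^t=-2\varphi_i\rho_i^t\Big(1-\big(1-\tfrac{\rho_i^t}{N\phi(t)}\big)^{K}\Big)-\frac{K}{N\phi(t)}\Big(1-\tfrac{\rho_i^t}{N\phi(t)}\Big)^{K-1}\Big(\varphi_i(\rho_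i^t)^2+(1-\varphi_i)(\alpha_i^t)^2\Big).$$
   Context: $N$ is the number of clients, $K=\tau N$ (with $\tau\in(0,1]$) the number of clients sampled per iteration, $T$ the number of global iterations, $t\in\{0,1,\dots,T\}$. $\rho_i^t\in[\rho_L,\rho_H]$ is the privacy budget of client $i$ at iteration $t$ (the state variable, with given initial value $\rho_i^0$), $\varphi_i\in(0,1)$ a weight parameter, $R_t$ the reward announced by the central server. The mean-field term $\phi(t)$ stands for the average privacy budget $\frac1N\sum_{j=1}^N\rho_j^t$; in this statement it is treated as a given function of $t$, not affected by $\alpha_i^t$. The quantity $\rho_i^t/(N\phi(t))$ is the sampling probability $x_i^t$ of client $i$, and $1-(1-x_i^t)^K$ is the probability that it is sampled. The formula for $\alpha_i^{t*}$ is implicit (backward recursive): the quantities $\rho_i^{\cdot}$, $\alpha_i^{r}$ and $S(j)$ on the right-hand side are those along the optimal trajectory; empty sums are zero, and the formula applies for $t\le T-1$. *)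

theory Defs
  imports Complex_Main
begin

text \<open>
  Conventions: \<open>\<phi>\<close> is the mean-field sequence (not affected by the control), \<open>w\<close> is the client's
  weight parameter \<open>\<phi>\<^sub>i\<close>, \<open>\<rho>\<close> and \<open>\<alpha>\<close> are the client's privacy budgets and correction factors.
  Only the values of \<open>\<alpha>\<close>, \<open>\<phi>\<close>, \<open>R\<close> at times up to the horizon \<open>T\<close> matter.
\<close>

primrec budget :: "(nat \<Rightarrow> real) \<Rightarrow> real \<Rightarrow> (nat \<Rightarrow> real) \<Rightarrow> nat \<Rightarrow> real" where
  "budget \<phi> \<rho>\<^sub>0 \<alpha> 0 = \<rho>\<^sub>0"
| "budget \<phi> \<rho>\<^sub>0 \<alpha> (Suc t) = (1 - \<alpha> t) * \<phi> t + \<alpha> t * budget \<phi> \<rho>\<^sub>0 \<alpha> t"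

definition samp_prob :: "nat \<Rightarrow> (nat \<Rightarrow> real) \<Rightarrow> (nat \<Rightarrow> real) \<Rightarrow> nat \<Rightarrow> real" where
  "samp_prob N \<phi> \<rho> t = \<rho> t / (real N * \<phi> t)"

definition sel_prob :: "nat \<Rightarrow> nat \<Rightarrow> (nat \<Rightarrow> real) \<Rightarrow> (nat \<Rightarrow> real) \<Rightarrow> nat \<Rightarrow> real" where
  "sel_prob N K \<phi> \<rho> t = 1 - (1 - samp_prob N \<phi> \<rho> t) ^ K"

definition utility ::
  "nat \<Rightarrow> nat \<Rightarrow> nat \<Rightarrow> real \<Rightarrow> (nat \<Rightarrow> real) \<Rightarrow> (nat \<Rightarrow> real) \<Rightarrow> real \<Rightarrow> (nat \<Rightarrow> real) \<Rightarrow> real" where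
  "utility N K T w R \<phi> \<rho>\<^sub>0 \<alpha> =
     (let \<rho> = budget \<phi> \<rho>\<^sub>0 \<alpha> in
      \<Sum>t=0..T. sel_prob N K \<phi> \<rho> t * (\<rho> t * R t - w * (\<rho> t)\<^sup>2 - (1 - w) * (\<alpha> t)\<^sup>2))"

text \<open>
  At the final time the value 0 has to be admissible: \<open>\<alpha> T\<close> only enters the utility through its
  own (negative) cost, so over the open interval no maximum is attained.
\<close>

definition admissible :: "nat \<Rightarrow> (nat \<Rightarrow> real) \<Rightarrow> bool" where
  "admissible T \<alpha> \<longleftrightarrow> (\<forall>t<T. 0 < \<alpha> t \<and> \<alpha> t < 1) \<and> 0 \<le> \<alpha> T \<and> \<alpha> T < 1"

definition optimal_control ::
  "nat \<Rightarrow> nat \<Rightarrow> nat \<Rightarrow> real \<Rightarrow> (nat \<Rightarrow> real) \<Rightarrow> (nat \<Rightarrow> real) \<Rightarrow> real \<Rightarrow> (nat \<Rightarrow> real) \<Rightarrow> bool" where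
  "optimal_control N K T w R \<phi> \<rho>\<^sub>0 \<alpha> \<longleftrightarrow>
     admissible T \<alpha> \<and>
     (\<forall>\<beta>. admissible T \<beta> \<longrightarrow> utility N K T w R \<phi> \<rho>\<^sub>0 \<beta> \<le> utility N K T w R \<phi> \<rho>\<^sub>0 \<alpha>)"

definition Q :: "nat \<Rightarrow> nat \<Rightarrow> (nat \<Rightarrow> real) \<Rightarrow> (nat \<Rightarrow> real) \<Rightarrow> nat \<Rightarrow> real" where
  "Q N K \<phi> \<rho> t =
     1 - (1 - \<rho> t / (real N * \<phi> t)) ^ K
       + (1 - \<rho> t / (real N * \<phi> t)) ^ (K - 1) * (real K * \<rho> t / (real N * \<phi> t))"

definition M ::
  "nat \<Rightarrow> nat \<Rightarrow> real \<Rightarrow> (nat \<Rightarrow> real) \<Rightarrow> (nat \<Rightarrow> real) \<Rightarrow> (nat \<Rightarrow> real) \<Rightarrow> nat \<Rightarrow> real" where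
  "M N K w \<phi> \<rho> \<alpha> t =
     - 2 * w * \<rho> t * (1 - (1 - \<rho> t / (real N * \<phi> t)) ^ K)
       - real K / (real N * \<phi> t) * (1 - \<rho> t / (real N * \<phi> t)) ^ (K - 1)
         * (w * (\<rho> t)\<^sup>2 + (1 - w) * (\<alpha> t)\<^sup>2)"

definition S ::
  "nat \<Rightarrow> nat \<Rightarrow> real \<Rightarrow> (nat \<Rightarrow> real) \<Rightarrow> (nat \<Rightarrow> real) \<Rightarrow> (nat \<Rightarrow> real) \<Rightarrow> (nat \<Rightarrow> real) \<Rightarrow> nat \<Rightarrow> real"
  where "S N K w R \<phi> \<rho> \<alpha> t = Q N K \<phi> \<rho> t * R t + M N K w \<phi> \<rho> \<alpha> t"

text \<open>
  The range of the privacy budgets is invariant under the dynamics, so it need not be imposed as a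
  separate state constraint.
\<close>

lemma budget_in_range:
  assumes "admissible T \<alpha>" "\<rho>\<^sub>0 \<in> {\<rho>\<^sub>L..\<rho>\<^sub>H}" "\<And>t. t \<le> T \<Longrightarrow> \<phi> t \<in> {\<rho>\<^sub>L..\<rho>\<^sub>H}" "t \<le> T"
  shows "budget \<phi> \<rho>\<^sub>0 \<alpha> t \<in> {\<rho>\<^sub>L..\<rho>\<^sub>H}"
  using assms(4)
proof (induction t)
  case 0
  then show ?case using assms(2) by simp
next
  case (Suc t)
  let ?b = "budget \<phi> \<rho>\<^sub>0 \<alpha> t"
  have "0 < \<alpha> t \<and> \<alpha> t < 1"
    using assms(1) Suc.prems by (simp add: admissible_def)
  then have a: "0 \<le> \<alpha> t" "0 \<le> 1 - \<alpha> t"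
    by simp_all
  have p: "\<rho>\<^sub>L \<le> \<phi> t" "\<phi> t \<le> \<rho>\<^sub>H" and b: "\<rho>\<^sub>L \<le> ?b" "?b \<le> \<rho>\<^sub>H"
    using assms(3)[of t] Suc by auto
  have "(1 - \<alpha> t) * \<rho>\<^sub>L + \<alpha> t * \<rho>\<^sub>L \<le> (1 - \<alpha> t) * \<phi> t + \<alpha> t * ?b"
    using a p b by (intro add_mono mult_left_mono) auto
  moreover have "(1 - \<alpha> t) * \<phi> t + \<alpha> t * ?b \<le> (1 - \<alpha> t) * \<rho>\<^sub>H + \<alpha> t * \<rho>\<^sub>H"
    using a p b by (intro add_mono mult_left_mono) auto
  ultimately show ?case by (simp add: algebra_simps)
qed

end

theory Submission
  imports Defs
begin

text \<open>
  First-order condition: for \<open>t < T\<close> the value \<open>\<alpha> t\<close> is an interior maximiser of the utility as a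
  function of \<open>\<alpha> t\<close> alone. Changing \<open>\<alpha> t\<close> moves the budget at time \<open>j > t\<close> at the rate
  \<open>(\<rho> t - \<phi> t) * (\<Prod>r=t+1..j-1. \<alpha> r)\<close>, and \<open>S j\<close> is the derivative of the running reward at time
  \<open>j\<close> in the budget; the only other contribution is the cost of \<open>\<alpha> t\<close> itself. Setting the total to
  zero and solving for \<open>\<alpha> t\<close> gives the formula.
\<close>

text \<open>The recursion for the budget at \<open>s\<close> reads only factors at times strictly
  before \<open>s\<close>, so the factor at \<open>t\<close> first acts on the budget at
  \<open>t+1\<close>.\<close>

lemma budget_fun_upd_eq:
  assumes "s \<le> t"
  shows "budget \<phi> \<rho>\<^sub>0 (\<alpha>(t := a)) s = budget \<phi> \<rho>\<^sub>0 \<alpha> s"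
  using assms by (induction s) auto

text \<open>The mean field is fixed, so each transition is affine in the budget: step
  \<open>t\<close> creates the rate \<rho> t - \<phi> t, and every later step \<open>s\<close>
  multiplies it by \<alpha> s. The half-open range makes the product empty at
  \<open>s = t+1\<close>.\<close>

lemma DERIV_budget:
  "((\<lambda>a. budget \<phi> \<rho>\<^sub>0 (\<alpha>(t := a)) s) has_field_derivative
      (if s \<le> t then 0 else (budget \<phi> \<rho>\<^sub>0 \<alpha> t - \<phi> t) * (\<Prod>r=t+1..<s. \<alpha> r))) (at (\<alpha> t))"
proof (induction s)
  case 0
  show ?case by simp
next
  case (Suc s)
  consider "s < t" | "s = t" | "t < s" by linarith
  then show ?case
  proof cases
    case 1
    then have "Suc s \<le> t" by simp
    then have "(\<lambda>a. budget \<phi> \<rho>\<^sub>0 (\<alpha>(t := a)) (Suc s)) = (\<lambda>a. budget \<phi> \<rho>\<^sub>0 \<alpha> (Suc s))"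
      by (intro ext budget_fun_upd_eq)
    with \<open>Suc s \<le> t\<close> show ?thesis by (simp only: DERIV_const if_True)
  next
    case 2
    have "((\<lambda>a. (1 - a) * \<phi> t + a * budget \<phi> \<rho>\<^sub>0 \<alpha> t) has_field_derivative
        budget \<phi> \<rho>\<^sub>0 \<alpha> t - \<phi> t) (at (\<alpha> t))"
      by (auto intro!: derivative_eq_intros)
    then show ?thesis
      unfolding 2 budget.simps fun_upd_same budget_fun_upd_eq[OF order_refl] by simp
  next
    case 3
    then have "((\<lambda>a. budget \<phi> \<rho>\<^sub>0 (\<alpha>(t := a)) s) has_field_derivative
        (budget \<phi> \<rho>\<^sub>0 \<alpha> t - \<phi> t) * (\<Prod>r=t+1..<s. \<alpha> r)) (at (\<alpha> t))"
      using Suc.IH by (simp only: not_le[symmetric] if_False)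
    note deriv = DERIV_add[OF DERIV_const DERIV_cmult[OF this]]
    from 3 have upd: "(\<alpha>(t := a)) s = \<alpha> s" for a by simp
    show ?thesis
      unfolding budget.simps upd
      \<comment> \<open>The new factor \<alpha> s extends the product over \<open>{t+1..<s}\<close>
        to \<open>{t+1..<Suc s}\<close>.\<close>
      by (rule DERIV_cong[OF deriv]) (use 3 in simp)
  qed
qed

text \<open>Chain rule with budget \<open>g\<close> and factor \<open>u\<close> as arbitrary
  differentiable functions of the perturbed variable, so that times before, at and after the
  perturbation are handled alike.\<close>

lemma DERIV_running_reward:
  assumes g: "(g has_field_derivative g') (at x)"
    and u: "(u has_field_derivative u') (at x)"
    and "g x = \<rho> j" and "u x = \<alpha> j"
  shows "((\<lambda>a. (1 - (1 - g a / (real N * \<phi> j)) ^ K) *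
            (g a * R j - w * (g a)\<^sup>2 - (1 - w) * (u a)\<^sup>2)) has_field_derivative
          S N K w R \<phi> \<rho> \<alpha> j * g' - 2 * (1 - w) * sel_prob N K \<phi> \<rho> j * \<alpha> j * u') (at x)"
proof -
  \<comment> \<open>With the constant inverse named, the expression is polynomial in
    \<open>g\<close> and \<open>u\<close>, and differentiation raises no side condition about
    denominators.\<close>
  define c where "c = inverse (real N * \<phi> j)"
  have "((\<lambda>a. (1 - (1 - g a * c) ^ K) *
            (g a * R j - w * (g a)\<^sup>2 - (1 - w) * (u a)\<^sup>2)) has_field_derivative
          (real K * c * (1 - \<rho> j * c) ^ (K - 1) * g') *
            (\<rho> j * R j - w * (\<rho> j)\<^sup>2 - (1 - w) * (\<alpha> j)\<^sup>2)
          + (1 - (1 - \<rho> j * c) ^ K) *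
            (g' * R j - w * (2 * \<rho> j * g') - (1 - w) * (2 * \<alpha> j * u'))) (at x)"
    using assms(3,4)
    by (auto intro!: derivative_eq_intros g u simp: algebra_simps)
  then show ?thesis
    unfolding S_def Q_def M_def sel_prob_def samp_prob_def divide_inverse c_def[symmetric]
    by (rule DERIV_cong) (simp add: algebra_simps)
qed

lemma DERIV_utility:
  fixes \<phi> \<alpha> :: "nat \<Rightarrow> real" and \<rho>\<^sub>0 :: real
  defines "\<rho> \<equiv> budget \<phi> \<rho>\<^sub>0 \<alpha>"
  assumes "t < T"
  shows "((\<lambda>a. utility N K T w R \<phi> \<rho>\<^sub>0 (\<alpha>(t := a))) has_field_derivative
      (\<rho> t - \<phi> t) * (\<Sum>j=t+1..T. S N K w R \<phi> \<rho> \<alpha> j * (\<Prod>r=t+1..<j. \<alpha> r))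
      - 2 * (1 - w) * sel_prob N K \<phi> \<rho> t * \<alpha> t) (at (\<alpha> t))"
proof -
  \<comment> \<open>Rates of change of the budget and of the factor at time \<open>j\<close> when
    only the factor at \<open>t\<close> varies.\<close>
  let ?b' = "\<lambda>j. if j \<le> t then 0 else (\<rho> t - \<phi> t) * (\<Prod>r=t+1..<j. \<alpha> r)"
  let ?u' = "\<lambda>j. if j = t then 1 else 0 :: real"
  have "((\<lambda>a. (1 - (1 - budget \<phi> \<rho>\<^sub>0 (\<alpha>(t := a)) j / (real N * \<phi> j)) ^ K) *
          (budget \<phi> \<rho>\<^sub>0 (\<alpha>(t := a)) j * R j - w * (budget \<phi> \<rho>\<^sub>0 (\<alpha>(t := a)) j)\<^sup>2
            - (1 - w) * ((\<alpha>(t := a)) j)\<^sup>2)) has_field_derivative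
        S N K w R \<phi> \<rho> \<alpha> j * ?b' j - 2 * (1 - w) * sel_prob N K \<phi> \<rho> j * \<alpha> j * ?u' j)
        (at (\<alpha> t))" for j
  proof (rule DERIV_running_reward)
    show "((\<lambda>a. (\<alpha>(t := a)) j) has_field_derivative ?u' j) (at (\<alpha> t))"
      by (cases "j = t") auto
    show "((\<lambda>a. budget \<phi> \<rho>\<^sub>0 (\<alpha>(t := a)) j) has_field_derivative ?b' j) (at (\<alpha> t))"
      unfolding \<rho>_def by (rule DERIV_budget)
  qed (simp_all add: \<rho>_def)
  then have "((\<lambda>a. utility N K T w R \<phi> \<rho>\<^sub>0 (\<alpha>(t := a))) has_field_derivative
      (\<Sum>j=0..T. S N K w R \<phi> \<rho> \<alpha> j * ?b' j
        - 2 * (1 - w) * sel_prob N K \<phi> \<rho> j * \<alpha> j * ?u' j)) (at (\<alpha> t))"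
    unfolding utility_def Let_def sel_prob_def samp_prob_def by (rule DERIV_sum)
  moreover have "(\<Sum>j=0..T. S N K w R \<phi> \<rho> \<alpha> j * ?b' j) =
      (\<Sum>j=t+1..T. S N K w R \<phi> \<rho> \<alpha> j * ?b' j)"
    by (rule sum.mono_neutral_right) auto
  moreover have "\<dots> =
      (\<rho> t - \<phi> t) * (\<Sum>j=t+1..T. S N K w R \<phi> \<rho> \<alpha> j * (\<Prod>r=t+1..<j. \<alpha> r))"
    unfolding sum_distrib_left by (rule sum.cong) (auto simp: mult_ac)
  moreover have "(\<Sum>j=0..T. 2 * (1 - w) * sel_prob N K \<phi> \<rho> j * \<alpha> j * ?u' j) =
      2 * (1 - w) * sel_prob N K \<phi> \<rho> t * \<alpha> t"
  proof -
    have "(\<Sum>j=0..T. 2 * (1 - w) * sel_prob N K \<phi> \<rho> j * \<alpha> j * ?u' j) =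
        (\<Sum>j=0..T. if j = t then 2 * (1 - w) * sel_prob N K \<phi> \<rho> j * \<alpha> j else 0)"
      by (rule sum.cong) auto
    with \<open>t < T\<close> show ?thesis by simp
  qed
  ultimately show ?thesis by (simp only: sum_subtractf)
qed

text \<open>The base 1 - x lies in [0,1), so its \<open>K\<close>-th power is at most the base
  itself and hence below 1.\<close>

lemma sel_prob_pos:
  assumes "0 < samp_prob N \<phi> \<rho> t" and "samp_prob N \<phi> \<rho> t \<le> 1" and "1 \<le> K"
  shows "0 < sel_prob N K \<phi> \<rho> t"
proof -
  have "(1 - samp_prob N \<phi> \<rho> t) ^ K \<le> (1 - samp_prob N \<phi> \<rho> t) ^ 1"
    using assms by (intro power_decreasing) auto
  with assms(1) show ?thesis by (simp add: sel_prob_def)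
qed

text \<open>No budget within the horizon depends on the last factor, so setting it to 0 only refunds
  its own cost.\<close>

lemma utility_fun_upd_final:
  "utility N K T w R \<phi> \<rho>\<^sub>0 (\<alpha>(T := 0)) =
    utility N K T w R \<phi> \<rho>\<^sub>0 \<alpha> + sel_prob N K \<phi> (budget \<phi> \<rho>\<^sub>0 \<alpha>) T * ((1 - w) * (\<alpha> T)\<^sup>2)"
  \<comment> \<open>The case split exposes the last summand; in all earlier ones neither the factor
    nor the budget changes.\<close>
  by (cases T)
    (simp_all add: utility_def Let_def sel_prob_def samp_prob_def budget_fun_upd_eq algebra_simps)

text \<open>Otherwise resetting the last factor to 0, which is admissible there, would strictly
  increase the utility.\<close>

lemma optimal_control_final:
  assumes opt: "optimal_control N K T w R \<phi> \<rho>\<^sub>0 \<alpha>"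
    and "w < 1" and "0 < sel_prob N K \<phi> (budget \<phi> \<rho>\<^sub>0 \<alpha>) T"
  shows "\<alpha> T = 0"
proof (rule ccontr)
  assume "\<alpha> T \<noteq> 0"
  with assms(2,3) have "0 < sel_prob N K \<phi> (budget \<phi> \<rho>\<^sub>0 \<alpha>) T * ((1 - w) * (\<alpha> T)\<^sup>2)"
    by simp
  moreover have "admissible T (\<alpha>(T := 0))"
    using opt by (auto simp: optimal_control_def admissible_def)
  ultimately show False
    using opt utility_fun_upd_final[of N K T w R \<phi> \<rho>\<^sub>0 \<alpha>] by (force simp: optimal_control_def)
qed

lemma optimal_control_stationary:
  fixes \<phi> \<alpha> :: "nat \<Rightarrow> real" and \<rho>\<^sub>0 :: real
  defines "\<rho> \<equiv> budget \<phi> \<rho>\<^sub>0 \<alpha>"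
  assumes opt: "optimal_control N K T w R \<phi> \<rho>\<^sub>0 \<alpha>" and "t < T"
  shows "2 * (1 - w) * sel_prob N K \<phi> \<rho> t * \<alpha> t =
    (\<rho> t - \<phi> t) * (\<Sum>j=t+1..T. S N K w R \<phi> \<rho> \<alpha> j * (\<Prod>r=t+1..<j. \<alpha> r))"
proof -
  have adm: "admissible T \<alpha>" using opt by (simp add: optimal_control_def)
  \<comment> \<open>This radius is the distance from \<alpha> t to the ends of the open unit
    interval, so every perturbation within it stays admissible.\<close>
  have "0 < min (\<alpha> t) (1 - \<alpha> t)" using adm \<open>t < T\<close> by (simp add: admissible_def)
  \<comment> \<open>The trivial update by \<alpha> t stays unsimplified so that both sides are
    values of the function differentiated in \<open>DERIV_utility\<close>.\<close>
  moreover have "\<forall>a. \<bar>\<alpha> t - a\<bar> < min (\<alpha> t) (1 - \<alpha> t) \<longrightarrow>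
      utility N K T w R \<phi> \<rho>\<^sub>0 (\<alpha>(t := a)) \<le> utility N K T w R \<phi> \<rho>\<^sub>0 (\<alpha>(t := \<alpha> t))"
  proof (intro allI impI)
    fix a
    assume "\<bar>\<alpha> t - a\<bar> < min (\<alpha> t) (1 - \<alpha> t)"
    then have "0 < a" "a < 1" by linarith+
    with adm \<open>t < T\<close> have "admissible T (\<alpha>(t := a))" by (simp add: admissible_def)
    with opt show "utility N K T w R \<phi> \<rho>\<^sub>0 (\<alpha>(t := a)) \<le> utility N K T w R \<phi> \<rho>\<^sub>0 (\<alpha>(t := \<alpha> t))"
      by (simp add: optimal_control_def)
  qed
  ultimately have "(\<rho> t - \<phi> t) * (\<Sum>j=t+1..T. S N K w R \<phi> \<rho> \<alpha> j * (\<Prod>r=t+1..<j. \<alpha> r))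
      - 2 * (1 - w) * sel_prob N K \<phi> \<rho> t * \<alpha> t = 0"
    unfolding \<rho>_def by (rule DERIV_local_max[OF DERIV_utility[OF \<open>t < T\<close>]])
  then show ?thesis by simp
qed

theorem theorem1:
  fixes N K T :: nat
    and \<tau> \<rho>\<^sub>L \<rho>\<^sub>H w \<rho>\<^sub>0 :: real
    and R \<phi> \<alpha> \<rho> :: "nat \<Rightarrow> real"
  assumes "N \<ge> 1"
    and "0 < \<tau>" and "\<tau> \<le> 1" and "real K = \<tau> * real N"
    and "0 < \<rho>\<^sub>L" and "\<rho>\<^sub>L \<le> \<rho>\<^sub>H"
    and "\<rho>\<^sub>0 \<in> {\<rho>\<^sub>L..\<rho>\<^sub>H}"
    and "\<And>t. t \<le> T \<Longrightarrow> \<phi> t \<in> {\<rho>\<^sub>L..\<rho>\<^sub>H}"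
    and "0 < w" and "w < 1"
    and "optimal_control N K T w R \<phi> \<rho>\<^sub>0 \<alpha>"
    and "\<rho> = budget \<phi> \<rho>\<^sub>0 \<alpha>"
    and "\<And>t. t \<le> T \<Longrightarrow> samp_prob N \<phi> \<rho> t \<le> 1"
  shows "(\<forall>t<T. \<alpha> t =
            (\<rho> t - \<phi> t) *
              ((\<Sum>j=t+2..T. S N K w R \<phi> \<rho> \<alpha> j * (\<Prod>r=t+1..j-1. \<alpha> r)) + S N K w R \<phi> \<rho> \<alpha> (t+1))
            / (2 * (1 - w) * (1 - (1 - \<rho> t / (real N * \<phi> t)) ^ K)))
         \<and> \<alpha> T = 0"
proof (intro conjI allI impI)
  have "0 < real K" using assms(1,2,4) by simp
  then have K: "1 \<le> K" by simp
  \<comment> \<open>The budget stays above \<open>\<rho>\<^sub>L\<close>, which is positive; this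
    makes the sampling probability positive and later permits the division.\<close>
  have sel: "0 < sel_prob N K \<phi> \<rho> t" if "t \<le> T" for t
  proof (rule sel_prob_pos[OF _ assms(13)[OF that] K])
    have "admissible T \<alpha>" using assms(11) by (simp add: optimal_control_def)
    then have "\<rho>\<^sub>L \<le> \<rho> t" using budget_in_range assms(7,8,12) that by fastforce
    then show "0 < samp_prob N \<phi> \<rho> t"
      using assms(1,5) assms(8)[OF that] by (simp add: samp_prob_def)
  qed
  show "\<alpha> T = 0"
    using optimal_control_final assms(10-12) sel by blast
  fix t
  assume t: "t < T"
  let ?S = "S N K w R \<phi> \<rho> \<alpha>"
  \<comment> \<open>The term \<open>j = t+1\<close> carries an empty product and becomes the
    separate summand of the formula.\<close>
  have "(\<Sum>j=t+1..T. ?S j * (\<Prod>r=t+1..<j. \<alpha> r)) =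
      ?S (t+1) + (\<Sum>j=t+2..T. ?S j * (\<Prod>r=t+1..<j. \<alpha> r))"
    using t by (simp add: sum.atLeast_Suc_atMost)
  also have "(\<Sum>j=t+2..T. ?S j * (\<Prod>r=t+1..<j. \<alpha> r)) =
      (\<Sum>j=t+2..T. ?S j * (\<Prod>r=t+1..j-1. \<alpha> r))"
  proof (rule sum.cong)
    fix j
    assume "j \<in> {t+2..T}"
    then have "{t+1..<j} = {t+1..j-1}" by auto
    then show "?S j * (\<Prod>r=t+1..<j. \<alpha> r) = ?S j * (\<Prod>r=t+1..j-1. \<alpha> r)" by simp
  qed simp
  finally have "2 * (1 - w) * sel_prob N K \<phi> \<rho> t * \<alpha> t =
      (\<rho> t - \<phi> t) * ((\<Sum>j=t+2..T. ?S j * (\<Prod>r=t+1..j-1. \<alpha> r)) + ?S (t+1))"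
    using optimal_control_stationary[OF assms(11) t] assms(12) by (simp only: add.commute)
  moreover have "2 * (1 - w) * sel_prob N K \<phi> \<rho> t \<noteq> 0"
    using sel[of t] t assms(10) by simp
  ultimately show "\<alpha> t =
      (\<rho> t - \<phi> t) * ((\<Sum>j=t+2..T. ?S j * (\<Prod>r=t+1..j-1. \<alpha> r)) + ?S (t+1))
        / (2 * (1 - w) * (1 - (1 - \<rho> t / (real N * \<phi> t)) ^ K))"
    unfolding samp_prob_def[symmetric] sel_prob_def[symmetric]
    by (subst nonzero_eq_divide_eq) (simp_all only: mult.commute not_False_eq_True)
qed

end
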